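(* Let $\mathcal H_i,\mathcal H_o$ be finite-dimensional complex Hilbert spaces, let $\widetilde P_i$ on $\mathcal L(\mathcal H_i)$ and $\widetilde P_o$ on $\mathcal L(\mathcal H_o)$ be linear, self-adjoint and unital projective maps that commute with transposition, and let $\{\widetilde P_{ia}\}_a$, $\{\widetilde P_{oa}\}_a$ be respective extensions, indexed by the finite-dimensional auxiliary spaces $\mathcal H_a$. Let $\gamma_i,\gamma_o$ and, for each $\mathcal H_a$, $\gamma_{ia},\gamma_{oa}$ be nonzero complex numbers with $\gamma_{oa}/\gamma_{ia}=\gamma_o/\gamma_i$. Suppose that for all $\mathcal H_a$ we have $\widetilde P_{ia}=\widetilde P_i\otimes\widetilde P_a$ and $\widetilde P_{oa}=\widetilde P_o\otimes\widetilde P_a$, where $\widetilde P_a$ is a projector on $\mathcal L(\mathcal H_a)$ that commutes with transposition. Then the requirement of complete admissibility adds no new restrictions: with $$\mathcal S_x=\{W\in\mathcal L(\mathcal H_x):\widetilde P_x[W]=W,\ \operatorname{tr}[W]=\gamma_x\},\qquad \mathcal S_{xa}=\{W\in\mathcal L(\mathcal H_x\otimes\mathcal H_a):\widetilde P_{xa}[W]=W,\ \operatorname{tr}[W]=\gamma_{xa}\}\qquad(x\in\{i,o\}),$$ every linear map $\widetilde T_{io}:\mathcal L(\mathcal H_i)\to\mathcal L(\mathcal H_o)$ with $\widetilde T_{io}[W]\in\mathcal S_o$ for all $W\in\mathcal S_i$ satisfies $(\widetilde T_{io}\otimes\widetilde{\mathbb 1}_a)[W_{ia}]\in\mathcal S_{oa}$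 for all $\mathcal H_a$ and all $W_{ia}\in\mathcal S_{ia}$.
   Context: $\mathcal L(\mathcal H)$ is the space of linear operators on $\mathcal H$; $\widetilde{\mathbb 1}_a$ is the identity map on $\mathcal L(\mathcal H_a)$. All Hilbert spaces carry fixed computational bases, with product bases on tensor products; $\tau$ is transposition in these bases. Projective map (projector): a linear map with $\widetilde P^2=\widetilde P$. Adjoint: $\operatorname{tr}[B^\dagger\widetilde P[A]]=\operatorname{tr}[\widetilde P^\dagger[B]^\dagger A]$ for all $A,B$; self-adjoint: $\widetilde P=\widetilde P^\dagger$; unital: $\widetilde P[\mathbb 1]=\mathbb 1$; commuting with transposition: $\widetilde P[W^\tau]=\widetilde P[W]^\tau$ for all $W$. Extension: for a projector $\widetilde P_x$ on $\mathcal L(\mathcal H_x)$, an extension is a family of projectors $\widetilde P_{xa}$ on $\mathcal L(\mathcal H_x\otimes\mathcal H_a)$, one for each auxiliary space $\mathcal H_a$, with $\widetilde P_{xa}\cong\widetilde P_x$ when $\mathcal H_a\cong\mathbb C$; whenever $\widetilde P_x$ is self-adjoint (resp. unital, commuting with transposition), all members $\widetilde P_{xa}$ of the family are assumed to be so too. *)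

theory Defs
  imports Complex_Main "Jordan_Normal_Form.Matrix" "Jordan_Normal_Form.Schur_Decomposition"
begin

text \<open>A finite-dimensional complex Hilbert space with a fixed computational basis is represented by
  its dimension \<open>n\<close>, and its space of linear operators by the complex \<open>n \<times> n\<close> matrices in that
  basis. The product basis vector with labels \<open>i < n\<close> and \<open>k < m\<close> of the tensor product has index
  \<open>i * m + k < n * m\<close>.\<close>

abbreviation ops :: "nat \<Rightarrow> complex mat set" where
  "ops n \<equiv> carrier_mat n n"

definition tr :: "complex mat \<Rightarrow> complex" where
  "tr A = (\<Sum>i<dim_row A. A $$ (i, i))"

definition kron :: "complex mat \<Rightarrow> complex mat \<Rightarrow> complex mat" where
  "kron A B = mat (dim_row A * dim_row B) (dim_col A * dim_col B)
     (\<lambda>(r, c). A $$ (r div dim_row B, c div dim_col B) * B $$ (r mod dim_row B, c mod dim_col B))"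

definition matrix_unit :: "nat \<Rightarrow> nat \<Rightarrow> nat \<Rightarrow> complex mat" where
  "matrix_unit n i j = mat n n (\<lambda>(r, c). if r = i \<and> c = j then 1 else 0)"

text \<open>Maps between operator spaces are HOL functions of which only the values on the carrier
  matter; in particular equality of such maps means equality on the carrier.\<close>

definition linear_ops :: "nat \<Rightarrow> nat \<Rightarrow> (complex mat \<Rightarrow> complex mat) \<Rightarrow> bool" where
  "linear_ops n m F \<longleftrightarrow>
     (\<forall>A \<in> ops n. F A \<in> ops m) \<and>
     (\<forall>A \<in> ops n. \<forall>B \<in> ops n. F (A + B) = F A + F B) \<and>
     (\<forall>c. \<forall>A \<in> ops n. F (c \<cdot>\<^sub>m A) = c \<cdot>\<^sub>m F A)"

definition projector :: "nat \<Rightarrow> (complex mat \<Rightarrow> complex mat) \<Rightarrow> bool" where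
  "projector n P \<longleftrightarrow> linear_ops n n P \<and> (\<forall>A \<in> ops n. P (P A) = P A)"

definition adjoint_maps ::
    "nat \<Rightarrow> (complex mat \<Rightarrow> complex mat) \<Rightarrow> (complex mat \<Rightarrow> complex mat) \<Rightarrow> bool" where
  "adjoint_maps n P Q \<longleftrightarrow>
     (\<forall>A \<in> ops n. \<forall>B \<in> ops n. tr (mat_adjoint B * P A) = tr (mat_adjoint (Q B) * A))"

definition self_adjoint :: "nat \<Rightarrow> (complex mat \<Rightarrow> complex mat) \<Rightarrow> bool" where
  "self_adjoint n P \<longleftrightarrow> adjoint_maps n P P"

definition unital :: "nat \<Rightarrow> (complex mat \<Rightarrow> complex mat) \<Rightarrow> bool" where
  "unital n P \<longleftrightarrow> P (1\<^sub>m n) = 1\<^sub>m n"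

definition commutes_transpose :: "nat \<Rightarrow> (complex mat \<Rightarrow> complex mat) \<Rightarrow> bool" where
  "commutes_transpose n P \<longleftrightarrow> (\<forall>W \<in> ops n. P (transpose_mat W) = transpose_mat (P W))"

text \<open>An extension is indexed by the dimension \<open>a\<close> of the auxiliary space. For \<open>a = 1\<close> the index
  convention above identifies the tensor product with the original space, \<open>n * 1 = n\<close>, so that the
  isomorphism of the member at \<open>a = 1\<close> with \<open>P\<close> is an equality.\<close>

definition extension ::
    "nat \<Rightarrow> (complex mat \<Rightarrow> complex mat) \<Rightarrow> (nat \<Rightarrow> complex mat \<Rightarrow> complex mat) \<Rightarrow> bool" where
  "extension n P PP \<longleftrightarrow>
     (\<forall>a. projector (n * a) (PP a)) \<and>
     (\<forall>W \<in> ops n. PP 1 W = P W) \<and>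
     (self_adjoint n P \<longrightarrow> (\<forall>a. self_adjoint (n * a) (PP a))) \<and>
     (unital n P \<longrightarrow> (\<forall>a. unital (n * a) (PP a))) \<and>
     (commutes_transpose n P \<longrightarrow> (\<forall>a. commutes_transpose (n * a) (PP a)))"

text \<open>Tensor product of \<open>F\<close> (from dimension \<open>n\<close> to \<open>n'\<close>) and \<open>G\<close> (from \<open>m\<close> to \<open>m'\<close>): the linear
  extension of \<open>kron A B \<mapsto> kron (F A) (G B)\<close>, computed by expanding the argument in products of
  matrix units. The lemmas \<open>linear_ops_tensor_map\<close>, \<open>tensor_map_kron\<close> and \<open>tensor_map_unique\<close>
  show that it is characterised by that property.\<close>

definition tensor_map ::
    "nat \<Rightarrow> nat \<Rightarrow> nat \<Rightarrow> nat \<Rightarrow> (complex mat \<Rightarrow> complex mat) \<Rightarrow> (complex mat \<Rightarrow> complex mat) \<Rightarrow>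
     complex mat \<Rightarrow> complex mat" where
  "tensor_map n n' m m' F G W = mat (n' * m') (n' * m') (\<lambda>(r, c).
     \<Sum>i<n. \<Sum>j<n. \<Sum>k<m. \<Sum>l<m. W $$ (i * m + k, j * m + l) *
       kron (F (matrix_unit n i j)) (G (matrix_unit m k l)) $$ (r, c))"

definition state_set :: "nat \<Rightarrow> (complex mat \<Rightarrow> complex mat) \<Rightarrow> complex \<Rightarrow> complex mat set" where
  "state_set n P \<gamma> = {W \<in> ops n. P W = W \<and> tr W = \<gamma>}"

lemma prod_index_less: "i * m + k < n * m" if "i < n" "k < m" for i k m n :: nat
proof -
  have "i * m + k < Suc i * m" using that by simp
  also have "\<dots> \<le> n * m" using that by (intro mult_le_mono1) simp
  finally show ?thesis .
qed

lemma linear_ops_sum_entry: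
  assumes F: "linear_ops n n' F" and I: "finite I" and A: "\<And>i. i \<in> I \<Longrightarrow> A i \<in> ops n"
  shows "mat n n (\<lambda>p. \<Sum>i\<in>I. c i * A i $$ p) \<in> ops n \<and>
    (\<forall>r<n'. \<forall>s<n'. F (mat n n (\<lambda>p. \<Sum>i\<in>I. c i * A i $$ p)) $$ (r, s) =
      (\<Sum>i\<in>I. c i * F (A i) $$ (r, s)))"
  using I A
proof (induction I rule: finite_induct)
  case empty
  let ?Z = "mat n n (\<lambda>_. 0 :: complex)"
  have Z: "?Z \<in> ops n" by simp
  have FZ: "F ?Z \<in> ops n'" using F Z unfolding linear_ops_def by blast
  have "0 \<cdot>\<^sub>m ?Z = ?Z" by (intro eq_matI) auto
  moreover have "F (0 \<cdot>\<^sub>m ?Z) = 0 \<cdot>\<^sub>m F ?Z" using F Z unfolding linear_ops_def by blast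
  ultimately have e: "F ?Z = 0 \<cdot>\<^sub>m F ?Z" by simp
  have "F ?Z $$ (r, s) = 0" if "r < n'" "s < n'" for r s
    using that FZ by (subst e) auto
  then show ?case by simp
next
  case (insert j I)
  let ?M = "mat n n (\<lambda>p. \<Sum>i\<in>I. c i * A i $$ p)"
  let ?N = "mat n n (\<lambda>p. \<Sum>i\<in>insert j I. c i * A i $$ p)"
  have Aj: "A j \<in> ops n" using insert.prems by simp
  have M: "?M \<in> ops n" by simp
  have cA: "c j \<cdot>\<^sub>m A j \<in> ops n" using Aj by simp
  have N: "?N = c j \<cdot>\<^sub>m A j + ?M"
    using insert.hyps Aj by (intro eq_matI) auto
  have "F ?N = F (c j \<cdot>\<^sub>m A j) + F ?M"
    unfolding N using F cA M unfolding linear_ops_def by blast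
  also have "F (c j \<cdot>\<^sub>m A j) = c j \<cdot>\<^sub>m F (A j)" using F Aj unfolding linear_ops_def by blast
  finally have FN: "F ?N = c j \<cdot>\<^sub>m F (A j) + F ?M" .
  have car: "F (A j) \<in> ops n'" "F ?M \<in> ops n'" using F Aj M unfolding linear_ops_def by blast+
  have "F ?N $$ (r, s) = (\<Sum>i\<in>insert j I. c i * F (A i) $$ (r, s))" if rs: "r < n'" "s < n'" for r s
  proof -
    have "F ?N $$ (r, s) = c j * F (A j) $$ (r, s) + F ?M $$ (r, s)"
      unfolding FN using rs car by simp
    then show ?thesis using insert.IH insert.prems insert.hyps rs by simp
  qed
  then show ?case by simp
qed

lemma linear_ops_expand:
  assumes F: "linear_ops n n' F" and A: "A \<in> ops n" and rs: "r < n'" "s < n'"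
  shows "F A $$ (r, s) = (\<Sum>i<n. \<Sum>j<n. A $$ (i, j) * F (matrix_unit n i j) $$ (r, s))"
proof -
  let ?I = "{..<n} \<times> {..<n}"
  have entry: "(\<Sum>p\<in>?I. A $$ p * matrix_unit n (fst p) (snd p) $$ (x, y)) = A $$ (x, y)"
    if "x < n" "y < n" for x y
  proof -
    have "(\<Sum>p\<in>?I. A $$ p * matrix_unit n (fst p) (snd p) $$ (x, y)) =
        (\<Sum>p\<in>?I. if p = (x, y) then A $$ p else 0)"
      using that by (intro sum.cong) (auto simp: matrix_unit_def)
    also have "\<dots> = A $$ (x, y)" using that by simp
    finally show ?thesis .
  qed
  have A_eq: "A = mat n n (\<lambda>q. \<Sum>p\<in>?I. A $$ p * matrix_unit n (fst p) (snd p) $$ q)"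
    using A entry by (intro eq_matI) auto
  have "F A $$ (r, s) = (\<Sum>p\<in>?I. A $$ p * F (matrix_unit n (fst p) (snd p)) $$ (r, s))"
    by (subst A_eq)
      (use linear_ops_sum_entry[OF F, of ?I "\<lambda>p. matrix_unit n (fst p) (snd p)" "\<lambda>p. A $$ p"] rs
        in \<open>auto simp: matrix_unit_def\<close>)
  then show ?thesis by (simp add: sum.cartesian_product case_prod_unfold)
qed

lemma linear_ops_tensor_map: "linear_ops (n * m) (n' * m') (tensor_map n n' m m' F G)"
  unfolding linear_ops_def
proof (intro conjI ballI allI)
  fix A B :: "complex mat" and c :: complex
  assume A: "A \<in> ops (n * m)"
  show "tensor_map n n' m m' F G A \<in> ops (n' * m')" by (simp add: tensor_map_def)
  show "tensor_map n n' m m' F G (c \<cdot>\<^sub>m A) = c \<cdot>\<^sub>m tensor_map n n' m m' F G A"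
    using A by (intro eq_matI)
      (auto simp: tensor_map_def sum_distrib_left prod_index_less mult.assoc intro!: sum.cong)
  assume B: "B \<in> ops (n * m)"
  show "tensor_map n n' m m' F G (A + B) = tensor_map n n' m m' F G A + tensor_map n n' m m' F G B"
    using A B by (intro eq_matI)
      (auto simp: tensor_map_def sum.distrib prod_index_less distrib_right)
qed

lemma tensor_map_kron:
  assumes F: "linear_ops n n' F" and G: "linear_ops m m' G" and A: "A \<in> ops n" and B: "B \<in> ops m"
  shows "tensor_map n n' m m' F G (kron A B) = kron (F A) (G B)"
proof -
  have FA: "F A \<in> ops n'" and GB: "G B \<in> ops m'" using F G A B unfolding linear_ops_def by blast+
  have FE: "F (matrix_unit n i j) \<in> ops n'" for i j
    using F unfolding linear_ops_def by (simp add: matrix_unit_def)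
  have GE: "G (matrix_unit m i j) \<in> ops m'" for i j
    using G unfolding linear_ops_def by (simp add: matrix_unit_def)
  show ?thesis
  proof (rule eq_matI)
    show "dim_row (tensor_map n n' m m' F G (kron A B)) = dim_row (kron (F A) (G B))"
      "dim_col (tensor_map n n' m m' F G (kron A B)) = dim_col (kron (F A) (G B))"
      using FA GB by (auto simp: tensor_map_def kron_def)
  next
    fix r s assume "r < dim_row (kron (F A) (G B))" "s < dim_col (kron (F A) (G B))"
    then have rs: "r < n' * m'" "s < n' * m'" using FA GB by (auto simp: kron_def)
    then have m': "m' > 0" by (cases m') auto
    have d: "r div m' < n'" "s div m' < n'" "r mod m' < m'" "s mod m' < m'"
      using rs m' by (auto simp: less_mult_imp_div_less)
    let ?f = "\<lambda>i j. A $$ (i, j) * F (matrix_unit n i j) $$ (r div m', s div m')"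
    let ?g = "\<lambda>k l. B $$ (k, l) * G (matrix_unit m k l) $$ (r mod m', s mod m')"
    have e: "kron A B $$ (i * m + k, j * m + l) *
        kron (F (matrix_unit n i j)) (G (matrix_unit m k l)) $$ (r, s) = ?f i j * ?g k l"
      if "i < n" "j < n" "k < m" "l < m" for i j k l
    proof -
      have "kron A B $$ (i * m + k, j * m + l) = A $$ (i, j) * B $$ (k, l)"
        using that A B by (simp add: kron_def prod_index_less)
      moreover have "kron (F (matrix_unit n i j)) (G (matrix_unit m k l)) $$ (r, s) =
          F (matrix_unit n i j) $$ (r div m', s div m') * G (matrix_unit m k l) $$ (r mod m', s mod m')"
        using FE[of i j] GE[of k l] rs by (simp add: kron_def)
      ultimately show ?thesis by simp
    qed
    have "tensor_map n n' m m' F G (kron A B) $$ (r, s) =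
        (\<Sum>i<n. \<Sum>j<n. \<Sum>k<m. \<Sum>l<m. ?f i j * ?g k l)"
      using rs e by (simp add: tensor_map_def)
    also have "\<dots> = (\<Sum>i<n. \<Sum>j<n. ?f i j) * (\<Sum>k<m. \<Sum>l<m. ?g k l)"
      by (simp only: sum_distrib_left[symmetric] sum_distrib_right[symmetric])
    also have "\<dots> = F A $$ (r div m', s div m') * G B $$ (r mod m', s mod m')"
      using linear_ops_expand[OF F A d(1,2)] linear_ops_expand[OF G B d(3,4)] by simp
    also have "\<dots> = kron (F A) (G B) $$ (r, s)" using FA GB rs by (simp add: kron_def)
    finally show "tensor_map n n' m m' F G (kron A B) $$ (r, s) = kron (F A) (G B) $$ (r, s)" .
  qed
qed

lemma kron_matrix_unit:
  assumes "i < n * m" "j < n * m"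
  shows "matrix_unit (n * m) i j =
    kron (matrix_unit n (i div m) (j div m)) (matrix_unit m (i mod m) (j mod m))"
proof -
  have m: "m > 0" using assms by (cases m) auto
  show ?thesis
  proof (rule eq_matI, goal_cases)
    case (1 x y)
    then have xy: "x < n * m" "y < n * m" by (auto simp: matrix_unit_def kron_def)
    have iff: "u = v \<longleftrightarrow> u div m = v div m \<and> u mod m = v mod m" for u v
      by (metis div_mult_mod_eq)
    have "x div m < n" "y div m < n" "x mod m < m" "y mod m < m"
      using xy m by (auto simp: less_mult_imp_div_less)
    then show ?case
      using xy iff[of x i] iff[of y j] by (simp add: matrix_unit_def kron_def)
  qed (simp_all add: matrix_unit_def kron_def)
qed

lemma tensor_map_unique:
  assumes F: "linear_ops n n' F" and G: "linear_ops m m' G" and H: "linear_ops (n * m) (n' * m') H"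
    and prod: "\<And>A B. A \<in> ops n \<Longrightarrow> B \<in> ops m \<Longrightarrow> H (kron A B) = kron (F A) (G B)"
    and W: "W \<in> ops (n * m)"
  shows "H W = tensor_map n n' m m' F G W"
proof -
  have eq: "H (matrix_unit (n * m) i j) = tensor_map n n' m m' F G (matrix_unit (n * m) i j)"
    if "i < n * m" "j < n * m" for i j
    unfolding kron_matrix_unit[OF that]
    by (simp add: prod tensor_map_kron[OF F G] matrix_unit_def)
  have HW: "H W \<in> ops (n' * m')" using H W unfolding linear_ops_def by blast
  show ?thesis
  proof (rule eq_matI)
    fix r s assume "r < dim_row (tensor_map n n' m m' F G W)" "s < dim_col (tensor_map n n' m m' F G W)"
    then have rs: "r < n' * m'" "s < n' * m'" by (auto simp: tensor_map_def)
    show "H W $$ (r, s) = tensor_map n n' m m' F G W $$ (r, s)"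
      unfolding linear_ops_expand[OF H W rs] linear_ops_expand[OF linear_ops_tensor_map W rs]
      using eq by simp
  qed (use HW in \<open>auto simp: tensor_map_def\<close>)
qed

end

theory Submission
  imports Defs
begin

text \<open>Since \<open>P_i\<close> is unital, every element of its range becomes an element of the input state set
  after adding a multiple of the identity, and so does zero. By linearity \<open>T\<close> therefore maps the
  range of \<open>P_i\<close> into that of \<open>P_o\<close> and scales the trace on it by \<open>\<gamma>_o / \<gamma>_i\<close>. Hence \<open>P_o T P_i = T P_i\<close> and \<open>tr T P_i = (\<gamma>_o / \<gamma>_i) tr P_i\<close>, and both
  identities survive tensoring with \<open>P_a\<close>.\<close>

lemma linear_ops_carrier: "linear_ops n m F \<Longrightarrow> A \<in> ops n \<Longrightarrow> F A \<in> ops m"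
  by (simp add: linear_ops_def)

lemma linear_ops_add:
  "linear_ops n m F \<Longrightarrow> A \<in> ops n \<Longrightarrow> B \<in> ops n \<Longrightarrow> F (A + B) = F A + F B"
  by (simp add: linear_ops_def)

lemma linear_ops_smult: "linear_ops n m F \<Longrightarrow> A \<in> ops n \<Longrightarrow> F (c \<cdot>\<^sub>m A) = c \<cdot>\<^sub>m F A"
  by (simp add: linear_ops_def)

lemma linear_ops_id: "linear_ops n n (\<lambda>A. A)"
  by (simp add: linear_ops_def)

lemma linear_ops_comp:
  "linear_ops n m F \<Longrightarrow> linear_ops m k G \<Longrightarrow> linear_ops n k (\<lambda>A. G (F A))"
  by (simp add: linear_ops_def)

lemma matrix_unit_carrier [simp]: "matrix_unit n i j \<in> ops n"
  by (simp add: matrix_unit_def)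

text \<open>Both sides are linear in \<open>W\<close> and agree on Kronecker products, so the
  uniqueness of the tensor product of maps identifies them.\<close>

lemma tensor_map_comp:
  assumes F: "linear_ops n n' F" and G: "linear_ops m m' G"
    and F': "linear_ops n' n'' F'" and G': "linear_ops m' m'' G'"
    and W: "W \<in> ops (n * m)"
  shows "tensor_map n' n'' m' m'' F' G' (tensor_map n n' m m' F G W) =
    tensor_map n n'' m m'' (\<lambda>A. F' (F A)) (\<lambda>A. G' (G A)) W"
proof (rule tensor_map_unique[OF linear_ops_comp[OF F F'] linear_ops_comp[OF G G']
      linear_ops_comp[OF linear_ops_tensor_map linear_ops_tensor_map] _ W])
  fix A B assume A: "A \<in> ops n" and B: "B \<in> ops m"
  show "tensor_map n' n'' m' m'' F' G' (tensor_map n n' m m' F G (kron A B)) =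
      kron (F' (F A)) (G' (G B))"
    unfolding tensor_map_kron[OF F G A B]
    by (rule tensor_map_kron[OF F' G' linear_ops_carrier[OF F A] linear_ops_carrier[OF G B]])
qed

text \<open>The expansion evaluates the factors only at matrix units. This lets identities known
  only on the carrier, such as idempotence, be used inside a tensor product.\<close>

lemma tensor_map_cong:
  assumes "\<And>A. A \<in> ops n \<Longrightarrow> F A = F' A" "\<And>B. B \<in> ops m \<Longrightarrow> G B = G' B"
  shows "tensor_map n n' m m' F G W = tensor_map n n' m m' F' G' W"
  unfolding tensor_map_def using assms by simp

lemma tr_add: "A \<in> ops n \<Longrightarrow> B \<in> ops n \<Longrightarrow> tr (A + B) = tr A + tr B"
  by (simp add: tr_def sum.distrib)

lemma tr_smult: "A \<in> ops n \<Longrightarrow> tr (c \<cdot>\<^sub>m A) = c * tr A"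
  by (simp add: tr_def sum_distrib_left)

lemma tr_one: "tr (1\<^sub>m n) = of_nat n"
  by (simp add: tr_def)

lemma tr_kron:
  assumes A: "A \<in> ops n" and B: "B \<in> ops m"
  shows "tr (kron A B) = tr A * tr B"
proof -
  have "tr (kron A B) = (\<Sum>r<n * m. A $$ (r div m, r div m) * B $$ (r mod m, r mod m))"
    using A B by (simp add: tr_def kron_def)
  \<comment> \<open>Each diagonal index splits uniquely as \<open>r = i * m + k\<close>; for
    \<open>m = 0\<close> both index sets are empty.\<close>
  also have "\<dots> = (\<Sum>(i, k)\<in>{..<n} \<times> {..<m}. A $$ (i, i) * B $$ (k, k))"
  proof (rule sum.reindex_bij_witness[where i = "\<lambda>(i, k). i * m + k" and j = "\<lambda>r. (r div m, r mod m)"])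
    fix r assume "r \<in> {..<n * m}"
    then show "(r div m, r mod m) \<in> {..<n} \<times> {..<m}"
      by (cases "m = 0") (auto simp: less_mult_imp_div_less)
  qed (auto simp: prod_index_less)
  also have "\<dots> = tr A * tr B"
    using A B by (simp add: tr_def sum_product sum.cartesian_product)
  finally show ?thesis .
qed

text \<open>The trace passes through the expansion in matrix units and factors on each Kronecker
  product. Hence it sees \<open>F\<close> and \<open>G\<close> only through their traces
  there.\<close>

lemma tr_tensor_map:
  assumes F: "linear_ops n n' F" and G: "linear_ops m m' G"
  shows "tr (tensor_map n n' m m' F G W) =
    (\<Sum>i<n. \<Sum>j<n. \<Sum>k<m. \<Sum>l<m. W $$ (i * m + k, j * m + l) *
      (tr (F (matrix_unit n i j)) * tr (G (matrix_unit m k l))))"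
proof -
  let ?K = "\<lambda>i j k l. kron (F (matrix_unit n i j)) (G (matrix_unit m k l))"
  have FE: "F (matrix_unit n i j) \<in> ops n'" for i j
    using linear_ops_carrier[OF F] by simp
  have GE: "G (matrix_unit m k l) \<in> ops m'" for k l
    using linear_ops_carrier[OF G] by simp
  have K: "tr (?K i j k l) = (\<Sum>r<n' * m'. ?K i j k l $$ (r, r))" for i j k l
    using FE[of i j] GE[of k l] by (simp add: tr_def kron_def)
  have "tr (tensor_map n n' m m' F G W) =
      (\<Sum>r<n' * m'. \<Sum>i<n. \<Sum>j<n. \<Sum>k<m. \<Sum>l<m. W $$ (i * m + k, j * m + l) * ?K i j k l $$ (r, r))"
    by (simp add: tr_def tensor_map_def)
  also have "\<dots> =
      (\<Sum>i<n. \<Sum>j<n. \<Sum>k<m. \<Sum>l<m. \<Sum>r<n' * m'. W $$ (i * m + k, j * m + l) * ?K i j k l $$ (r, r))"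
    \<comment> \<open>Fixing the index set orients the swap: only the sum over \<open>r\<close>
      moves inwards.\<close>
    by (simp only: sum.swap[where A = "{..<n' * m'}"])
  also have "\<dots> = (\<Sum>i<n. \<Sum>j<n. \<Sum>k<m. \<Sum>l<m. W $$ (i * m + k, j * m + l) * tr (?K i j k l))"
    by (simp only: K sum_distrib_left)
  finally show ?thesis by (simp only: tr_kron[OF FE GE])
qed

lemma tr_tensor_map_scale:
  assumes F: "linear_ops n n' F" and F': "linear_ops n n'' F'" and G: "linear_ops m m' G"
    and c: "\<And>A. A \<in> ops n \<Longrightarrow> tr (F' A) = c * tr (F A)"
  shows "tr (tensor_map n n'' m m' F' G W) = c * tr (tensor_map n n' m m' F G W)"
  unfolding tr_tensor_map[OF F G] tr_tensor_map[OF F' G]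
  by (simp add: c sum_distrib_left mult_ac)

text \<open>Two states suffice. The first, a multiple of the identity, determines how
  \<open>Q\<close> and \<open>tr\<close> act on the image of the identity; subtracting that
  contribution from the image of the second, a shift of \<open>A\<close>, isolates
  \<open>T A\<close>.\<close>

lemma admissible_on_range:
  assumes P: "projector n P" and u: "unital n P" and Q: "projector m Q" and T: "linear_ops n m T"
    and adm: "\<And>W. W \<in> state_set n P \<gamma> \<Longrightarrow> T W \<in> state_set m Q \<delta>"
    and "n > 0" "\<gamma> \<noteq> 0" and A: "A \<in> ops n" "P A = A"
  shows "Q (T A) = T A" and "tr (T A) = \<delta> / \<gamma> * tr A"
proof -
  have PL: "linear_ops n n P" and QL: "linear_ops m m Q"
    using P Q by (simp_all add: projector_def)
  let ?I = "1\<^sub>m n :: complex mat"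
  \<comment> \<open>The shift for which \<open>A + c I\<close> has trace \<gamma>, as
    \<open>tr I = n\<close>.\<close>
  define c where "c = (\<gamma> - tr A) / of_nat n"
  \<comment> \<open>The multiple of the identity with trace \<gamma>; it is nonzero, so it can be
    cancelled below.\<close>
  define d where "d = \<gamma> / of_nat n"
  have cI: "c \<cdot>\<^sub>m ?I \<in> ops n" by simp
  have PI: "P (e \<cdot>\<^sub>m ?I) = e \<cdot>\<^sub>m ?I" for e
    using linear_ops_smult[OF PL, of ?I e] u by (simp add: unital_def)
  have TI: "T ?I \<in> ops m" and TA: "T A \<in> ops m" and QTA: "Q (T A) \<in> ops m"
    using linear_ops_carrier[OF T] linear_ops_carrier[OF QL] A by simp_all
  have "d \<cdot>\<^sub>m ?I \<in> state_set n P \<gamma>"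
    using \<open>n > 0\<close> by (simp add: state_set_def PI tr_smult[of _ n] tr_one d_def)
  from adm[OF this] have "d \<cdot>\<^sub>m T ?I \<in> state_set m Q \<delta>"
    by (simp add: linear_ops_smult[OF T])
  then have Qd: "d \<cdot>\<^sub>m Q (T ?I) = d \<cdot>\<^sub>m T ?I" and td: "d * tr (T ?I) = \<delta>"
    using TI by (simp_all add: state_set_def linear_ops_smult[OF QL] tr_smult)
  have "d \<noteq> 0" using \<open>n > 0\<close> \<open>\<gamma> \<noteq> 0\<close> by (simp add: d_def)
  have QI: "Q (T ?I) = T ?I"
  proof (rule eq_matI)
    fix r s assume "r < dim_row (T ?I)" "s < dim_col (T ?I)"
    then show "Q (T ?I) $$ (r, s) = T ?I $$ (r, s)"
      using arg_cong[OF Qd, of "\<lambda>M. M $$ (r, s)"] TI linear_ops_carrier[OF QL TI] \<open>d \<noteq> 0\<close> by simp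
  qed (use TI linear_ops_carrier[OF QL TI] in auto)
  have "A + c \<cdot>\<^sub>m ?I \<in> state_set n P \<gamma>"
    using A \<open>n > 0\<close>
    by (simp add: state_set_def linear_ops_add[OF PL] PI tr_add[of _ n] tr_smult[of _ n] tr_one c_def)
  from adm[OF this] have "T A + c \<cdot>\<^sub>m T ?I \<in> state_set m Q \<delta>"
    using A by (simp add: linear_ops_add[OF T] linear_ops_smult[OF T])
  then have Qs: "Q (T A) + c \<cdot>\<^sub>m T ?I = T A + c \<cdot>\<^sub>m T ?I" and ts: "tr (T A) + c * tr (T ?I) = \<delta>"
    using TI TA
    by (simp_all add: state_set_def linear_ops_add[OF QL] linear_ops_smult[OF QL] QI
        tr_add[of _ m] tr_smult[of _ m])
  show "Q (T A) = T A"
  proof (rule eq_matI)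
    fix r s assume "r < dim_row (T A)" "s < dim_col (T A)"
    then show "Q (T A) $$ (r, s) = T A $$ (r, s)"
      using arg_cong[OF Qs, of "\<lambda>M. M $$ (r, s)"] TI TA QTA by simp
  qed (use TA QTA in auto)
  have tI: "tr (T ?I) = \<delta> / d" using td \<open>d \<noteq> 0\<close> by (simp add: field_simps)
  have "tr (T A) = \<delta> - c * (\<delta> / d)" using ts by (simp add: tI algebra_simps)
  \<comment> \<open>Since \<open>c / d = 1 - tr A / \<gamma>\<close>, the constant terms
    cancel.\<close>
  then show "tr (T A) = \<delta> / \<gamma> * tr A"
    using \<open>n > 0\<close> \<open>\<gamma> \<noteq> 0\<close> by (simp add: c_def d_def field_simps)
qed

theorem lemma3:
  fixes n_i n_o :: nat
    and P_i P_o :: "complex mat \<Rightarrow> complex mat"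
    and P_ia P_oa P_a :: "nat \<Rightarrow> complex mat \<Rightarrow> complex mat"
    and \<gamma>_i \<gamma>_o :: complex
    and \<gamma>_ia \<gamma>_oa :: "nat \<Rightarrow> complex"
  assumes "projector n_i P_i" "self_adjoint n_i P_i" "unital n_i P_i" "commutes_transpose n_i P_i"
    and "projector n_o P_o" "self_adjoint n_o P_o" "unital n_o P_o" "commutes_transpose n_o P_o"
    and "extension n_i P_i P_ia" "extension n_o P_o P_oa"
    and "\<gamma>_i \<noteq> 0" "\<gamma>_o \<noteq> 0" "\<forall>a. \<gamma>_ia a \<noteq> 0" "\<forall>a. \<gamma>_oa a \<noteq> 0"
    and "\<forall>a. \<gamma>_oa a / \<gamma>_ia a = \<gamma>_o / \<gamma>_i"
    and "\<forall>a. projector a (P_a a) \<and> commutes_transpose a (P_a a)"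
    and "\<forall>a. \<forall>W \<in> ops (n_i * a). P_ia a W = tensor_map n_i n_i a a P_i (P_a a) W"
    and "\<forall>a. \<forall>W \<in> ops (n_o * a). P_oa a W = tensor_map n_o n_o a a P_o (P_a a) W"
  shows "\<forall>T_io. linear_ops n_i n_o T_io \<and>
      (\<forall>W \<in> state_set n_i P_i \<gamma>_i. T_io W \<in> state_set n_o P_o \<gamma>_o) \<longrightarrow>
      (\<forall>a. \<forall>W_ia \<in> state_set (n_i * a) (P_ia a) (\<gamma>_ia a).
        tensor_map n_i n_o a a T_io (\<lambda>A. A) W_ia \<in> state_set (n_o * a) (P_oa a) (\<gamma>_oa a))"
proof (intro allI impI ballI)
  fix T a W
  assume "linear_ops n_i n_o T \<and> (\<forall>W \<in> state_set n_i P_i \<gamma>_i. T W \<in> state_set n_o P_o \<gamma>_o)"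
    and W_state: "W \<in> state_set (n_i * a) (P_ia a) (\<gamma>_ia a)"
  then have T: "linear_ops n_i n_o T"
    and adm: "\<And>W. W \<in> state_set n_i P_i \<gamma>_i \<Longrightarrow> T W \<in> state_set n_o P_o \<gamma>_o"
    by auto
  have Pi: "linear_ops n_i n_i P_i" "\<And>A. A \<in> ops n_i \<Longrightarrow> P_i (P_i A) = P_i A"
    and Po: "linear_ops n_o n_o P_o"
    and Pa: "linear_ops a a (P_a a)" "\<And>A. A \<in> ops a \<Longrightarrow> P_a a (P_a a A) = P_a a A"
    using assms(1,5,16) by (simp_all add: projector_def)
  have W: "W \<in> ops (n_i * a)" and trW: "tr W = \<gamma>_ia a"
    and W_eq: "tensor_map n_i n_i a a P_i (P_a a) W = W"
    using W_state assms(17) by (auto simp: state_set_def)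
  \<comment> \<open>In dimension zero \<open>W\<close> would be the empty matrix, whose trace 0 is
    excluded by \<open>\<gamma>_ia a \<noteq> 0\<close>.\<close>
  have "n_i > 0" using W trW assms(13) by (cases "n_i = 0") (auto simp: tr_def)
  \<comment> \<open>By idempotence every \<open>P_i A\<close> lies in the range of
    \<open>P_i\<close>, so the lemma applies to it for arbitrary \<open>A\<close> in the
    carrier.\<close>
  note range = admissible_on_range[OF assms(1,3,5) T adm \<open>n_i > 0\<close> assms(11)
      linear_ops_carrier[OF Pi(1)] Pi(2)]
  let ?V = "tensor_map n_i n_o a a T (\<lambda>A. A) W"
  \<comment> \<open>As \<open>W\<close> is fixed by the product projector, that projector can be
    inserted before \<open>T\<close>. From here on \<open>T\<close> meets only elements of the range
    of \<open>P_i\<close>, although \<open>W\<close> itself need not be a product.\<close>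
  have V: "?V = tensor_map n_i n_o a a (\<lambda>A. T (P_i A)) (P_a a) W"
    using tensor_map_comp[OF Pi(1) Pa(1) T linear_ops_id W] by (simp add: W_eq)
  have V_car: "?V \<in> ops (n_o * a)"
    using linear_ops_carrier[OF linear_ops_tensor_map W] .
  have "P_oa a ?V = tensor_map n_o n_o a a P_o (P_a a) ?V"
    using assms(18) V_car by blast
  also have "\<dots> = tensor_map n_i n_o a a (\<lambda>A. P_o (T (P_i A))) (\<lambda>B. P_a a (P_a a B)) W"
    unfolding V by (rule tensor_map_comp[OF linear_ops_comp[OF Pi(1) T] Pa(1) Po Pa(1) W])
  \<comment> \<open>\<open>P_o\<close> is absorbed on the first factor by admissibility, the second
    \<open>P_a a\<close> by idempotence.\<close>
  also have "\<dots> = ?V"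
    unfolding V by (rule tensor_map_cong) (simp_all add: range(1) Pa(2))
  finally have fixed: "P_oa a ?V = ?V" .
  \<comment> \<open>The two tensor products share the factor \<open>P_a a\<close>, so only the ratio
    of traces on the first factor enters.\<close>
  have "tr ?V = \<gamma>_o / \<gamma>_i * tr (tensor_map n_i n_i a a P_i (P_a a) W)"
    unfolding V by (rule tr_tensor_map_scale[OF Pi(1) linear_ops_comp[OF Pi(1) T] Pa(1) range(2)])
  also have "\<dots> = \<gamma>_oa a / \<gamma>_ia a * \<gamma>_ia a"
    unfolding W_eq trW using assms(15) by simp
  also have "\<dots> = \<gamma>_oa a" using assms(13) by simp
  finally show "?V \<in> state_set (n_o * a) (P_oa a) (\<gamma>_oa a)"
    using V_car fixed by (simp add: state_set_def)
qed

end
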